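(* Let $H$ be a separable real Hilbert space. For every $\nu\in\mathcal P_2(H)$ the function $\mathsf k_\nu:\mathcal P_2(H)\to\mathbb R$, $\mathsf k_\nu(\mu):=[\mu,\nu]$, is $m_2(\nu)$-Lipschitz with respect to $w_2$ and totally convex.
   Context: $\mathcal P_2(H)$ is the space of Borel probability measures $\mu$ on $H$ with finite quadratic moment $m_2^2(\mu):=\int_H|x|^2\,d\mu(x)$. $\Gamma(\mu,\nu)$ is the set of couplings, i.e. Borel probability measures on $H\times H$ with marginals $\mu,\nu$. The Wasserstein metric is $w_2^2(\mu,\nu):=\min\{\int|x-y|^2\,d\gamma:\gamma\in\Gamma(\mu,\nu)\}$ and the maximal correlation pairing is $[\mu,\nu]:=\max\{\int\langle x,y\rangle\,d\gamma(x,y):\gamma\in\Gamma(\mu,\nu)\}$. A function $\phi:\mathcal P_2(H)\to\mathbb R\cup\{+\infty\}$ is totally convex if for every coupling $\boldsymbol\mu\in\mathcal P_2(H\times H)$ with first marginal $\mu_0$ and second marginal $\mu_1$, and every $t\in[0,1]$, the measure $\mu_t:=(\pi_t)_\sharp\boldsymbol\mu$, $\pi_t(x_1,x_2):=(1-t)x_1+tx_2$, satisfies $\phi(\mu_t)\le(1-t)\phi(\mu_0)+t\phi(\mu_1)$. *)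

theory Defs
  imports "HOL-Probability.Probability"
begin

definition P2 :: "'a::real_normed_vector measure set" where
  "P2 = {\<mu>. prob_space \<mu> \<and> sets \<mu> = sets borel \<and> integrable \<mu> (\<lambda>x. (norm x)\<^sup>2)}"

definition m2 :: "'a::real_normed_vector measure \<Rightarrow> real" where
  "m2 \<mu> = sqrt (\<integral>x. (norm x)\<^sup>2 \<partial>\<mu>)"

definition couplings ::
    "'a::topological_space measure \<Rightarrow> 'b::topological_space measure \<Rightarrow> ('a \<times> 'b) measure set" where
  "couplings \<mu> \<nu> = {\<gamma>. prob_space \<gamma> \<and> sets \<gamma> = sets borel \<and>
     distr \<gamma> borel fst = \<mu> \<and> distr \<gamma> borel snd = \<nu>}"

text \<open>On \<^const>\<open>P2\<close> the minimum and the maximum over couplings exist, so they coincide with the real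
  infimum and supremum used below. That these two are taken over nonempty sets of genuine (finite)
  integrals, bounded on the relevant side, is shown at the end of this theory; outside
  \<^const>\<open>P2\<close> the values are meaningless.\<close>

definition w2 :: "'a::real_normed_vector measure \<Rightarrow> 'a measure \<Rightarrow> real" where
  "w2 \<mu> \<nu> = sqrt (INF \<gamma>\<in>couplings \<mu> \<nu>. \<integral>z. (norm (fst z - snd z))\<^sup>2 \<partial>\<gamma>)"

definition max_corr :: "'a::real_inner measure \<Rightarrow> 'a measure \<Rightarrow> real" where
  "max_corr \<mu> \<nu> = (SUP \<gamma>\<in>couplings \<mu> \<nu>. \<integral>z. fst z \<bullet> snd z \<partial>\<gamma>)"

definition k_fun :: "'a::real_inner measure \<Rightarrow> 'a measure \<Rightarrow> real" where
  "k_fun \<nu> \<mu> = max_corr \<mu> \<nu>"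

text \<open>Functions on \<^const>\<open>P2\<close> are total functions on measures of which only the values on
  \<^const>\<open>P2\<close> matter. The first conjunct of total convexity says that the values lie in the reals
  extended by plus infinity; the convention \<open>0 * \<infinity> = 0\<close> of \<^typ>\<open>ereal\<close> is the usual one of convex
  analysis at the endpoints of the unit interval.\<close>

definition lipschitz_w2 :: "real \<Rightarrow> ('a::real_normed_vector measure \<Rightarrow> real) \<Rightarrow> bool" where
  "lipschitz_w2 C f \<longleftrightarrow> 0 \<le> C \<and> (\<forall>\<mu>\<in>P2. \<forall>\<mu>'\<in>P2. \<bar>f \<mu> - f \<mu>'\<bar> \<le> C * w2 \<mu> \<mu>')"

definition totally_convex :: "('a::real_inner measure \<Rightarrow> ereal) \<Rightarrow> bool" where
  "totally_convex \<phi> \<longleftrightarrow>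
     (\<forall>\<mu>\<in>P2. \<phi> \<mu> \<noteq> -\<infinity>) \<and>
     (\<forall>M::('a \<times> 'a) measure. M \<in> P2 \<longrightarrow> (\<forall>t\<in>{0..1::real}.
        \<phi> (distr M borel (\<lambda>z. (1 - t) *\<^sub>R fst z + t *\<^sub>R snd z))
          \<le> ereal (1 - t) * \<phi> (distr M borel fst) + ereal t * \<phi> (distr M borel snd)))"

lemma P2_D:
  assumes "\<mu> \<in> P2"
  shows "prob_space \<mu>" "sets \<mu> = sets borel" "integrable \<mu> (\<lambda>x. (norm x)\<^sup>2)"
  using assms by (auto simp: P2_def)

lemma couplings_nonempty:
  fixes \<mu> \<nu> :: "'a::{real_inner,second_countable_topology} measure"
  assumes "\<mu> \<in> P2" "\<nu> \<in> P2"
  shows "couplings \<mu> \<nu> \<noteq> {}"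
proof -
  note m = P2_D[OF assms(1)] and n = P2_D[OF assms(2)]
  interpret M: prob_space \<mu> by (rule m)
  interpret N: prob_space \<nu> by (rule n)
  interpret P: pair_prob_space \<mu> \<nu> ..
  have s: "sets (\<mu> \<Otimes>\<^sub>M \<nu>) = sets borel"
    using sets_pair_measure_cong[OF m(2) n(2)] by (simp only: borel_prod)
  have f: "distr (\<mu> \<Otimes>\<^sub>M \<nu>) borel fst = \<mu>"
    using N.distr_pair_fst[of \<mu>] distr_cong[OF refl m(2), of "\<mu> \<Otimes>\<^sub>M \<nu>" fst fst]
      by (simp add: N.emeasure_space_1)
  have g: "distr (\<mu> \<Otimes>\<^sub>M \<nu>) borel snd = \<nu>"
  proof (rule measure_eqI)
    show "sets (distr (\<mu> \<Otimes>\<^sub>M \<nu>) borel snd) = sets \<nu>" using n(2) by simp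
    fix A assume "A \<in> sets (distr (\<mu> \<Otimes>\<^sub>M \<nu>) borel snd)"
    then have A: "A \<in> sets \<nu>" "A \<in> sets borel" using n(2) by auto
    have "snd -` A \<inter> space (\<mu> \<Otimes>\<^sub>M \<nu>) = space \<mu> \<times> A"
      using sets.sets_into_space[OF A(1)] by (auto simp: space_pair_measure)
    moreover have "snd \<in> measurable (\<mu> \<Otimes>\<^sub>M \<nu>) borel"
      using measurable_snd[of \<mu> \<nu>] measurable_cong_sets[OF refl n(2)] by blast
    ultimately show "emeasure (distr (\<mu> \<Otimes>\<^sub>M \<nu>) borel snd) A = emeasure \<nu> A"
      using A by (simp add: emeasure_distr N.emeasure_pair_measure_Times M.emeasure_space_1)
  qed
  have "\<mu> \<Otimes>\<^sub>M \<nu> \<in> couplings \<mu> \<nu>"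
    using s f g P.prob_space_axioms by (simp add: couplings_def)
  then show ?thesis by blast
qed

lemma coupling_integrals:
  fixes \<mu> \<nu> :: "'a::{real_inner,second_countable_topology} measure"
  assumes "\<mu> \<in> P2" "\<nu> \<in> P2" "\<gamma> \<in> couplings \<mu> \<nu>"
  shows "integrable \<gamma> (\<lambda>z. fst z \<bullet> snd z)"
    and "integrable \<gamma> (\<lambda>z. (norm (fst z - snd z))\<^sup>2)"
    and "(\<integral>z. fst z \<bullet> snd z \<partial>\<gamma>) \<le> ((m2 \<mu>)\<^sup>2 + (m2 \<nu>)\<^sup>2) / 2"
proof -
  have G: "sets \<gamma> = sets borel" "distr \<gamma> borel fst = \<mu>" "distr \<gamma> borel snd = \<nu>"
    using assms(3) by (auto simp: couplings_def)
  have mf: "fst \<in> measurable \<gamma> borel" and ms: "snd \<in> measurable \<gamma> borel"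
    unfolding measurable_cong_sets[OF G(1) refl]
    by (auto intro!: borel_measurable_continuous_onI continuous_intros)
  have i1: "integrable \<gamma> (\<lambda>z. (norm (fst z))\<^sup>2)"
    using P2_D(3)[OF assms(1)] integrable_distr[OF mf, of "\<lambda>x. (norm x)\<^sup>2"] G(2) by simp
  have i2: "integrable \<gamma> (\<lambda>z. (norm (snd z))\<^sup>2)"
    using P2_D(3)[OF assms(2)] integrable_distr[OF ms, of "\<lambda>x. (norm x)\<^sup>2"] G(3) by simp
  have e1: "(m2 \<mu>)\<^sup>2 = (\<integral>z. (norm (fst z))\<^sup>2 \<partial>\<gamma>)"
    using integral_distr[OF mf, of "\<lambda>x. (norm x)\<^sup>2"] G(2) by (simp add: m2_def)
  have e2: "(m2 \<nu>)\<^sup>2 = (\<integral>z. (norm (snd z))\<^sup>2 \<partial>\<gamma>)"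
    using integral_distr[OF ms, of "\<lambda>x. (norm x)\<^sup>2"] G(3) by (simp add: m2_def)
  have b: "\<bar>x \<bullet> y\<bar> \<le> ((norm x)\<^sup>2 + (norm y)\<^sup>2) / 2" for x y :: 'a
    using Cauchy_Schwarz_ineq2[of x y] sum_squares_bound[of "norm x" "norm y"] by simp
  have i12: "integrable \<gamma> (\<lambda>z. ((norm (fst z))\<^sup>2 + (norm (snd z))\<^sup>2) / 2)"
    using i1 i2 by simp
  show I: "integrable \<gamma> (\<lambda>z. fst z \<bullet> snd z)"
    by (rule Bochner_Integration.integrable_bound[OF i12])
       (use mf ms b in \<open>auto intro!: order_trans[OF b]\<close>)
  have "(\<lambda>z. (norm (fst z - snd z))\<^sup>2)
      = (\<lambda>z::'a\<times>'a. (norm (fst z))\<^sup>2 + (norm (snd z))\<^sup>2 - 2 * (fst z \<bullet> snd z))"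
    by (simp add: power2_norm_eq_inner inner_diff inner_commute algebra_simps)
  then show "integrable \<gamma> (\<lambda>z. (norm (fst z - snd z))\<^sup>2)"
    using i1 i2 I by simp
  have "(\<integral>z. fst z \<bullet> snd z \<partial>\<gamma>) \<le> (\<integral>z. ((norm (fst z))\<^sup>2 + (norm (snd z))\<^sup>2) / 2 \<partial>\<gamma>)"
    by (rule integral_mono[OF I i12]) (use b abs_le_D1 in blast)
  then show "(\<integral>z. fst z \<bullet> snd z \<partial>\<gamma>) \<le> ((m2 \<mu>)\<^sup>2 + (m2 \<nu>)\<^sup>2) / 2"
    using i1 i2 by (simp add: e1 e2)
qed

lemma max_corr_bdd_above:
  fixes \<mu> \<nu> :: "'a::{real_inner,second_countable_topology} measure"
  assumes "\<mu> \<in> P2" "\<nu> \<in> P2"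
  shows "bdd_above ((\<lambda>\<gamma>. \<integral>z. fst z \<bullet> snd z \<partial>\<gamma>) ` couplings \<mu> \<nu>)"
  using coupling_integrals(3)[OF assms] by (rule bdd_aboveI2)

lemma w2_bdd_below:
  "bdd_below ((\<lambda>\<gamma>. \<integral>z. (norm (fst z - snd z))\<^sup>2 \<partial>\<gamma>) ` couplings \<mu> \<nu>)"
  by (intro bdd_belowI2[where m = 0]) simp

text \<open>Whenever an optimal coupling exists, \<^const>\<open>max_corr\<close> and \<^const>\<open>w2\<close> are the maximum and
  (the square root of) the minimum.\<close>

lemma max_corr_eq_maximum:
  assumes "\<gamma> \<in> couplings \<mu> \<nu>"
    and "\<And>\<gamma>'. \<gamma>' \<in> couplings \<mu> \<nu> \<Longrightarrow> (\<integral>z. fst z \<bullet> snd z \<partial>\<gamma>') \<le> (\<integral>z. fst z \<bullet> snd z \<partial>\<gamma>)"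
  shows "max_corr \<mu> \<nu> = (\<integral>z. fst z \<bullet> snd z \<partial>\<gamma>)"
  unfolding max_corr_def using assms by (intro cSup_eq_maximum) auto

lemma w2_eq_minimum:
  assumes "\<gamma> \<in> couplings \<mu> \<nu>"
    and "\<And>\<gamma>'. \<gamma>' \<in> couplings \<mu> \<nu> \<Longrightarrow>
      (\<integral>z. (norm (fst z - snd z))\<^sup>2 \<partial>\<gamma>) \<le> (\<integral>z. (norm (fst z - snd z))\<^sup>2 \<partial>\<gamma>')"
  shows "(w2 \<mu> \<nu>)\<^sup>2 = (\<integral>z. (norm (fst z - snd z))\<^sup>2 \<partial>\<gamma>)"
proof -
  have "(INF \<gamma>\<in>couplings \<mu> \<nu>. \<integral>z. (norm (fst z - snd z))\<^sup>2 \<partial>\<gamma>)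
      = (\<integral>z. (norm (fst z - snd z))\<^sup>2 \<partial>\<gamma>)"
    using assms by (intro cInf_eq_minimum) auto
  then show ?thesis by (simp add: w2_def)
qed

end

theory Submission
  imports Defs
begin

text \<open>Let \<open>M\<close> be a probability measure, \<open>f\<close> a map with law \<open>\<mu>\<close> under \<open>M\<close>, and \<open>\<gamma>\<close> a coupling of
  \<open>\<mu>\<close> and \<open>\<nu>\<close>. Gluing \<open>M\<close> and \<open>\<gamma>\<close> along \<open>\<mu>\<close> exactly needs a disintegration of measures. As the
  maximal correlation is a supremum, gluing up to \<open>\<epsilon>\<close> is enough: split the Hilbert space into
  countably many Borel cells of diameter less than \<open>\<epsilon>\<close>, and couple \<open>M\<close> and \<open>\<gamma>\<close> independently
  conditionally on the cell. This gives a coupling \<open>\<beta>\<close> of \<open>M\<close> and \<open>\<nu>\<close> with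
  \<open>\<integral>\<langle>z, y\<rangle> d\<gamma> \<le> \<integral>\<langle>f x, y\<rangle> d\<beta> + \<epsilon> m\<^sub>2(\<nu>)\<close>. Total convexity follows with \<open>f = \<pi>\<^sub>t\<close> by linearity of the
  inner product, and the Lipschitz bound follows with \<open>M\<close> a coupling of \<open>\<mu>\<close> and \<open>\<mu>'\<close> and \<open>f\<close> the
  first projection by the Cauchy--Schwarz inequality.\<close>

section \<open>Cauchy-Schwarz inequality for square-integrable vector-valued maps\<close>

text \<open>The integral of \<open>(norm (u x - c *\<^sub>R v x))\<^sup>2\<close> is nonnegative for
  every real \<open>c\<close>. As a quadratic polynomial in \<open>c\<close> it therefore has no
  positive discriminant, which is the inequality.\<close>

lemma
  fixes u v :: "'a \<Rightarrow> 'b::{real_inner,second_countable_topology}"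
  assumes [measurable]: "u \<in> borel_measurable M" "v \<in> borel_measurable M"
    and u: "integrable M (\<lambda>x. (norm (u x))\<^sup>2)" and v: "integrable M (\<lambda>x. (norm (v x))\<^sup>2)"
  shows integrable_inner: "integrable M (\<lambda>x. u x \<bullet> v x)"
    and integral_inner_le:
      "(\<integral>x. u x \<bullet> v x \<partial>M) \<le> sqrt (\<integral>x. (norm (u x))\<^sup>2 \<partial>M) * sqrt (\<integral>x. (norm (v x))\<^sup>2 \<partial>M)"
proof -
  let ?A = "\<integral>x. (norm (u x))\<^sup>2 \<partial>M" and ?B = "\<integral>x. (norm (v x))\<^sup>2 \<partial>M" and ?I = "\<integral>x. u x \<bullet> v x \<partial>M"
  have b: "\<bar>x \<bullet> y\<bar> \<le> (norm x)\<^sup>2 + (norm y)\<^sup>2" for x y :: 'b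
  proof -
    have "\<bar>x \<bullet> y\<bar> \<le> norm x * norm y" by (rule Cauchy_Schwarz_ineq2)
    also have "\<dots> \<le> 2 * norm x * norm y" by simp
    also have "\<dots> \<le> (norm x)\<^sup>2 + (norm y)\<^sup>2" by (rule sum_squares_bound)
    finally show ?thesis .
  qed
  show i: "integrable M (\<lambda>x. u x \<bullet> v x)"
    by (rule Bochner_Integration.integrable_bound[OF Bochner_Integration.integrable_add[OF u v]])
       (use b in simp_all)
  have q: "0 \<le> ?A - 2 * c * ?I + c\<^sup>2 * ?B" for c
  proof -
    have "0 \<le> (\<integral>x. (norm (u x - c *\<^sub>R v x))\<^sup>2 \<partial>M)" by simp
    also have "\<dots> = (\<integral>x. (norm (u x))\<^sup>2 - (2 * c) * (u x \<bullet> v x) + c\<^sup>2 * (norm (v x))\<^sup>2 \<partial>M)"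
      by (intro Bochner_Integration.integral_cong refl)
         (simp add: power2_norm_eq_inner inner_diff inner_commute algebra_simps power2_eq_square[of c])
    also have "\<dots> = ?A - 2 * c * ?I + c\<^sup>2 * ?B"
      using u v i by simp
    finally show ?thesis .
  qed
  have "?I\<^sup>2 \<le> ?A * ?B"
  proof (cases "?B = 0")
    case True
    have "?I = 0"
    proof (rule ccontr)
      assume "?I \<noteq> 0"
      \<comment> \<open>With \<open>?B = 0\<close> the polynomial is affine in \<open>c\<close>;
        this \<open>c\<close> gives it the value \<open>?A - (?A + 1)\<close>, which is
        negative.\<close>
      then show False using q[of "(?A + 1) / (2 * ?I)"] True
        by simp
    qed
    then show ?thesis using True by simp
  next
    case False
    moreover have "0 \<le> ?B" by simp
    ultimately have "0 < ?B" by linarith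
    \<comment> \<open>The polynomial is evaluated at its minimiser \<open>?I / ?B\<close>.\<close>
    moreover have "0 \<le> ?A - ?I\<^sup>2 / ?B"
      using q[of "?I / ?B"] False by (simp add: power2_eq_square)
    ultimately show ?thesis by (simp add: pos_divide_le_eq)
  qed
  then have "?I \<le> sqrt (?A * ?B)" by (rule real_le_rsqrt)
  then show "?I \<le> sqrt ?A * sqrt ?B" by (simp add: real_sqrt_mult)
qed

section \<open>Gluing of measures, first over countably many cells, then up to a small
  distance\<close>

text \<open>In \<open>ennreal\<close> the product is 1 on a fibre of positive mass, which is finite
  here, but 0 on a null fibre. There are countably many labels, so the null fibres together are
  still null. The lemma cancels the normalising factor in \<open>countable_gluing\<close>.\<close>

lemma AE_inverse_emeasure_fibre:
  fixes i :: "'a \<Rightarrow> 'k::countable"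
  assumes "prob_space M" and i [measurable]: "i \<in> M \<rightarrow>\<^sub>M count_space UNIV"
  shows "AE x in M. inverse (emeasure M {y \<in> space M. i y = i x}) * emeasure M {y \<in> space M. i y = i x} = 1"
proof -
  interpret prob_space M by fact
  \<comment> \<open>Quantifying over a fixed label \<open>k\<close> instead of \<open>i x\<close>
    makes the exceptional set a countable union of null sets.\<close>
  have "AE x in M. \<forall>k. emeasure M {y \<in> space M. i y = k} = 0 \<longrightarrow> i x \<noteq> k"
    unfolding AE_all_countable
  proof
    fix k
    have "AE x in M. i x \<noteq> k" if "emeasure M {y \<in> space M. i y = k} = 0"
      using that by (intro AE_I[where N = "{y \<in> space M. i y = k}"]) auto
    then show "AE x in M. emeasure M {y \<in> space M. i y = k} = 0 \<longrightarrow> i x \<noteq> k"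
      by (cases "emeasure M {y \<in> space M. i y = k} = 0") auto
  qed
  then have p: "AE x in M. emeasure M {y \<in> space M. i y = i x} \<noteq> 0"
    by eventually_elim auto
  show "AE x in M. inverse (emeasure M {y \<in> space M. i y = i x}) * emeasure M {y \<in> space M. i y = i x} = 1"
    using p
  proof eventually_elim
    case (elim x)
    then show ?case
      by (subst mult.commute, simp flip: divide_ennreal_def)
         (intro ennreal_divide_self, simp_all add: emeasure_eq_measure)
  qed
qed

text \<open>The coupling draws a label \<open>k\<close> with the common probability of the fibres
  \<open>i = k\<close> and \<open>j = k\<close>, then draws the two points independently from
  \<open>M\<close> and \<open>N\<close> conditioned on their fibres.\<close>

lemma countable_gluing:
  fixes M :: "'a::second_countable_topology measure" and N :: "'b::second_countable_topology measure"
    and i :: "'a \<Rightarrow> 'k::countable" and j :: "'b \<Rightarrow> 'k"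
  assumes M: "prob_space M" "sets M = sets borel" and N: "prob_space N" "sets N = sets borel"
    and [measurable]: "i \<in> M \<rightarrow>\<^sub>M count_space UNIV" "j \<in> N \<rightarrow>\<^sub>M count_space UNIV"
    and eq: "\<And>k. emeasure M {x \<in> space M. i x = k} = emeasure N {y \<in> space N. j y = k}"
  obtains \<beta> where "\<beta> \<in> couplings M N" "AE z in \<beta>. i (fst z) = j (snd z)"
proof -
  interpret M: prob_space M by fact
  interpret N: prob_space N by fact
  interpret P: pair_prob_space M N ..
  define p where "p k = emeasure M {x \<in> space M. i x = k}" for k
  \<comment> \<open>Density of that mixture with respect to the product measure: on the block of
    label \<open>k\<close>, dividing by \<open>p k\<close> turns the product of the restricted
    measures into \<open>p k\<close> times the product of the conditional ones. Blocks with
    \<open>p k = 0\<close> are null, so the infinite value there does no harm.\<close>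
  define h where "h z = (if i (fst z) = j (snd z) then inverse (p (i (fst z))) else 0)"
    for z :: "'a \<times> 'b"
  have [measurable]: "h \<in> borel_measurable (M \<Otimes>\<^sub>M N)"
    unfolding h_def by measurable
  define \<beta> where "\<beta> = density (M \<Otimes>\<^sub>M N) h"
  have sP: "sets (M \<Otimes>\<^sub>M N) = sets borel"
    using sets_pair_measure_cong[OF M(2) N(2)] by (simp only: borel_prod)
  have f [measurable]: "fst \<in> M \<Otimes>\<^sub>M N \<rightarrow>\<^sub>M borel" "snd \<in> M \<Otimes>\<^sub>M N \<rightarrow>\<^sub>M borel"
    using measurable_fst[of M N] measurable_snd[of M N]
      measurable_cong_sets[OF refl M(2)] measurable_cong_sets[OF refl N(2)] by blast+
  have h1: "(\<integral>\<^sup>+y. h (x, y) \<partial>N) = inverse (p (i x)) * p (i x)" for x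
  proof -
    have "(\<integral>\<^sup>+y. h (x, y) \<partial>N) = (\<integral>\<^sup>+y. inverse (p (i x)) * indicator {y \<in> space N. j y = i x} y \<partial>N)"
      by (intro nn_integral_cong) (auto simp: h_def)
    \<comment> \<open>Equality of the fibre masses enters here: the factor built from the
      \<open>M\<close>-mass also normalises the \<open>N\<close>-fibre.\<close>
    also have "\<dots> = inverse (p (i x)) * p (i x)"
      by (subst nn_integral_cmult_indicator) (auto simp: p_def eq)
    finally show ?thesis .
  qed
  have h2: "(\<integral>\<^sup>+x. h (x, y) \<partial>M) = inverse (p (j y)) * p (j y)" for y
  proof -
    have "(\<integral>\<^sup>+x. h (x, y) \<partial>M) = (\<integral>\<^sup>+x. inverse (p (j y)) * indicator {x \<in> space M. i x = j y} x \<partial>M)"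
      by (intro nn_integral_cong) (auto simp: h_def)
    also have "\<dots> = inverse (p (j y)) * p (j y)"
      by (subst nn_integral_cmult_indicator) (auto simp: p_def)
    finally show ?thesis .
  qed
  have d1: "distr \<beta> borel fst = M"
  proof (rule measure_eqI)
    show "sets (distr \<beta> borel fst) = sets M" using M(2) by simp
    fix A assume "A \<in> sets (distr \<beta> borel fst)"
    then have A [measurable]: "A \<in> sets borel" "A \<in> sets M" using M(2) by auto
    have "emeasure (distr \<beta> borel fst) A = (\<integral>\<^sup>+z. h z * indicator A (fst z) \<partial>(M \<Otimes>\<^sub>M N))"
      unfolding \<beta>_def
      by (subst emeasure_distr, simp, simp, subst emeasure_density)
         (auto intro!: nn_integral_cong simp: indicator_def)
    also have "\<dots> = (\<integral>\<^sup>+x. (\<integral>\<^sup>+y. h (x, y) * indicator A x \<partial>N) \<partial>M)"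
      by (subst N.nn_integral_fst[symmetric]) auto
    also have "\<dots> = (\<integral>\<^sup>+x. (inverse (p (i x)) * p (i x)) * indicator A x \<partial>M)"
      by (intro nn_integral_cong) (simp add: nn_integral_multc h1)
    also have "\<dots> = (\<integral>\<^sup>+x. indicator A x \<partial>M)"
      using AE_inverse_emeasure_fibre[OF M(1), of i]
      by (intro nn_integral_cong_AE) (auto simp: p_def)
    finally show "emeasure (distr \<beta> borel fst) A = emeasure M A" by simp
  qed
  have d2: "distr \<beta> borel snd = N"
  proof (rule measure_eqI)
    show "sets (distr \<beta> borel snd) = sets N" using N(2) by simp
    fix A assume "A \<in> sets (distr \<beta> borel snd)"
    then have A [measurable]: "A \<in> sets borel" "A \<in> sets N" using N(2) by auto
    have "emeasure (distr \<beta> borel snd) A = (\<integral>\<^sup>+z. h z * indicator A (snd z) \<partial>(M \<Otimes>\<^sub>M N))"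
      unfolding \<beta>_def
      by (subst emeasure_distr, simp, simp, subst emeasure_density)
         (auto intro!: nn_integral_cong simp: indicator_def)
    also have "\<dots> = (\<integral>\<^sup>+y. (\<integral>\<^sup>+x. h (x, y) * indicator A y \<partial>M) \<partial>N)"
      by (subst P.nn_integral_snd[symmetric]) auto
    also have "\<dots> = (\<integral>\<^sup>+y. (inverse (p (j y)) * p (j y)) * indicator A y \<partial>N)"
      by (intro nn_integral_cong) (simp add: nn_integral_multc h2)
    also have "\<dots> = (\<integral>\<^sup>+y. indicator A y \<partial>N)"
      using AE_inverse_emeasure_fibre[OF N(1), of j]
      by (intro nn_integral_cong_AE) (auto simp: p_def eq)
    finally show "emeasure (distr \<beta> borel snd) A = emeasure N A" by simp
  qed
  have s\<beta>: "sets \<beta> = sets borel" by (simp add: \<beta>_def sP)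
  \<comment> \<open>The total mass of \<open>\<beta>\<close> is read off from its first
    marginal.\<close>
  have "prob_space (distr \<beta> borel fst)" by (simp add: d1 M)
  then have "prob_space \<beta>"
    using f(1) by (intro prob_space_distrD[of fst \<beta> borel]) (auto simp: \<beta>_def)
  then have "\<beta> \<in> couplings M N"
    using s\<beta> d1 d2 by (simp add: couplings_def)
  moreover have "AE z in \<beta>. i (fst z) = j (snd z)"
    unfolding \<beta>_def by (subst AE_density) (auto simp: h_def)
  ultimately show thesis by (rule that)
qed

text \<open>Label each point by the first member of a dense sequence within \<open>e / 2\<close> of
  it. Points with the same label share a centre, and a triangle inequality through it
  finishes.\<close>

lemma countable_small_cells:
  fixes e :: real
  assumes "0 < e"
  obtains c :: "'a::{metric_space,second_countable_topology} \<Rightarrow> nat"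
  where "c \<in> borel \<rightarrow>\<^sub>M count_space UNIV" "\<And>x y. c x = c y \<Longrightarrow> dist x y < e"
proof -
  obtain D :: "'a set" where D: "countable D" "\<And>X. open X \<Longrightarrow> X \<noteq> {} \<Longrightarrow> \<exists>d\<in>D. d \<in> X"
    using countable_dense_setE by metis
  define c where "c x = (LEAST n. dist x (from_nat_into D n) < e / 2)" for x
  have "\<exists>n. dist x (from_nat_into D n) < e / 2" for x
  proof -
    obtain d where "d \<in> D" "d \<in> ball x (e / 2)"
      using D(2)[of "ball x (e / 2)"] assms by auto
    then show ?thesis using from_nat_into_surj[OF D(1)] by (metis mem_ball)
  qed
  then have c: "dist x (from_nat_into D (c x)) < e / 2" for x
    unfolding c_def by (rule LeastI_ex)
  show thesis
  proof
    show "c \<in> borel \<rightarrow>\<^sub>M count_space UNIV"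
      unfolding c_def by measurable
    fix x y :: 'a assume "c x = c y"
    then show "dist x y < e"
      using c[of x] c[of y] dist_triangle_half_r[of "from_nat_into D (c x)" x e y]
      by (simp add: dist_commute)
  qed
qed

text \<open>Since \<open>f\<close> and \<open>g\<close> have the same law, the preimages of each
  small cell have equal mass. So \<open>countable_gluing\<close> applies to the cell labels of
  \<open>f\<close> and \<open>g\<close>, and points in one cell are closer than
  \<open>e\<close>.\<close>

lemma approximate_gluing:
  fixes M :: "'a::second_countable_topology measure" and N :: "'b::second_countable_topology measure"
    and f :: "'a \<Rightarrow> 'c::{metric_space,second_countable_topology}"
  assumes M: "prob_space M" "sets M = sets borel" and N: "prob_space N" "sets N = sets borel"
    and f [measurable]: "f \<in> M \<rightarrow>\<^sub>M borel" and g [measurable]: "g \<in> N \<rightarrow>\<^sub>M borel"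
    and eq: "distr M borel f = distr N borel g" and "0 < e"
  obtains \<beta> where "\<beta> \<in> couplings M N" "AE z in \<beta>. dist (f (fst z)) (g (snd z)) < e"
proof -
  obtain c :: "'c \<Rightarrow> nat" where c [measurable]: "c \<in> borel \<rightarrow>\<^sub>M count_space UNIV"
    and d: "\<And>x y. c x = c y \<Longrightarrow> dist x y < e"
    using countable_small_cells[OF \<open>0 < e\<close>] by blast
  have "emeasure M {x \<in> space M. c (f x) = k} = emeasure N {y \<in> space N. c (g y) = k}" for k
  proof -
    have [measurable]: "{w. c w = k} \<in> sets borel"
      using measurable_sets[OF c, of "{k}"] by (simp add: vimage_def)
    have "emeasure M {x \<in> space M. c (f x) = k} = emeasure (distr M borel f) {w. c w = k}"
      by (subst emeasure_distr) (auto intro!: arg_cong[where f = "emeasure M"])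
    also have "\<dots> = emeasure N {y \<in> space N. c (g y) = k}"
      unfolding eq by (subst emeasure_distr) (auto intro!: arg_cong[where f = "emeasure N"])
    finally show ?thesis .
  qed
  then obtain \<beta> where "\<beta> \<in> couplings M N" "AE z in \<beta>. c (f (fst z)) = c (g (snd z))"
    using countable_gluing[OF M N, of "\<lambda>x. c (f x)" "\<lambda>y. c (g y)"] by auto
  then show thesis by (intro that[of \<beta>]) (auto intro: d)
qed

section \<open>Marginal integrals and images of couplings\<close>

lemma couplingsD:
  assumes "\<gamma> \<in> couplings \<mu> \<nu>"
  shows "prob_space \<gamma>" "sets \<gamma> = sets borel" "distr \<gamma> borel fst = \<mu>" "distr \<gamma> borel snd = \<nu>"
  using assms by (auto simp: couplings_def)

lemma measurable_couplings:
  fixes \<mu> :: "'a::second_countable_topology measure" and \<nu> :: "'b::second_countable_topology measure"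
  assumes "\<gamma> \<in> couplings \<mu> \<nu>"
  shows "fst \<in> \<gamma> \<rightarrow>\<^sub>M borel" "snd \<in> \<gamma> \<rightarrow>\<^sub>M borel"
  unfolding measurable_cong_sets[OF couplingsD(2)[OF assms] refl]
  by (auto simp flip: borel_prod)

lemma
  fixes \<mu> :: "'a::second_countable_topology measure" and \<nu> :: "'b::second_countable_topology measure"
    and \<psi> :: "_ \<Rightarrow> real"
  assumes "\<gamma> \<in> couplings \<mu> \<nu>"
  shows integrable_couplings_fst:
      "\<psi> \<in> borel_measurable borel \<Longrightarrow> integrable \<gamma> (\<lambda>z. \<psi> (fst z)) \<longleftrightarrow> integrable \<mu> \<psi>"
    and integral_couplings_fst:
      "\<psi> \<in> borel_measurable borel \<Longrightarrow> (\<integral>z. \<psi> (fst z) \<partial>\<gamma>) = (\<integral>x. \<psi> x \<partial>\<mu>)"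
  using integrable_distr_eq[OF measurable_couplings(1)[OF assms], of \<psi>]
    integral_distr[OF measurable_couplings(1)[OF assms], of \<psi>]
  by (simp_all add: couplingsD(3)[OF assms])

lemma
  fixes \<mu> :: "'a::second_countable_topology measure" and \<nu> :: "'b::second_countable_topology measure"
    and \<psi> :: "_ \<Rightarrow> real"
  assumes "\<gamma> \<in> couplings \<mu> \<nu>"
  shows integrable_couplings_snd:
      "\<psi> \<in> borel_measurable borel \<Longrightarrow> integrable \<gamma> (\<lambda>z. \<psi> (snd z)) \<longleftrightarrow> integrable \<nu> \<psi>"
    and integral_couplings_snd:
      "\<psi> \<in> borel_measurable borel \<Longrightarrow> (\<integral>z. \<psi> (snd z) \<partial>\<gamma>) = (\<integral>x. \<psi> x \<partial>\<nu>)"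
  using integrable_distr_eq[OF measurable_couplings(2)[OF assms], of \<psi>]
    integral_distr[OF measurable_couplings(2)[OF assms], of \<psi>]
  by (simp_all add: couplingsD(4)[OF assms])

lemma couplings_distr:
  fixes M :: "'a::second_countable_topology measure" and N :: "'b::second_countable_topology measure"
    and g :: "'a \<Rightarrow> 'c::second_countable_topology" and h :: "'b \<Rightarrow> 'd::second_countable_topology"
  assumes b: "\<beta> \<in> couplings M N"
    and [measurable]: "g \<in> borel \<rightarrow>\<^sub>M borel" "h \<in> borel \<rightarrow>\<^sub>M borel"
  shows "distr \<beta> borel (\<lambda>z. (g (fst z), h (snd z))) \<in> couplings (distr M borel g) (distr N borel h)"
proof -
  interpret prob_space \<beta> by (rule couplingsD[OF b])
  note [measurable] = measurable_couplings[OF b]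
  let ?h = "\<lambda>z. (g (fst z), h (snd z))"
  have m: "?h \<in> \<beta> \<rightarrow>\<^sub>M borel"
    by (simp flip: borel_prod)
  have "distr (distr \<beta> borel ?h) borel fst = distr (distr \<beta> borel fst) borel g"
    using m by (subst (1 2) distr_distr) (auto simp: comp_def simp flip: borel_prod)
  moreover have "distr (distr \<beta> borel ?h) borel snd = distr (distr \<beta> borel snd) borel h"
    using m by (subst (1 2) distr_distr) (auto simp: comp_def simp flip: borel_prod)
  ultimately show ?thesis
    using prob_space_distr[OF m] by (simp add: couplings_def couplingsD(3,4)[OF b])
qed

section \<open>Maximal correlation with an image measure\<close>

text \<open>Glue \<open>M\<close> and \<open>\<gamma>\<close> to a law of triples
  \<open>(x, (z, y))\<close> with \<open>f x\<close> within \<open>e\<close> of \<open>z\<close>,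
  and let \<open>\<beta>\<close> be the law of \<open>(x, y)\<close>. By Cauchy-Schwarz, replacing
  \<open>z\<close> by \<open>f x\<close> in the inner product with \<open>y\<close> costs at most
  \<open>e * m2 \<nu>\<close>.\<close>

lemma approximate_lifting:
  fixes M :: "'a::second_countable_topology measure"
    and \<nu> :: "'h::{real_inner,second_countable_topology} measure"
  assumes M: "prob_space M" "sets M = sets borel" and f: "f \<in> borel \<rightarrow>\<^sub>M borel"
    and f2: "integrable M (\<lambda>x. (norm (f x))\<^sup>2)" and \<nu>: "\<nu> \<in> P2"
    and \<gamma>: "\<gamma> \<in> couplings (distr M borel f) \<nu>" and "0 < e"
  obtains \<beta> where "\<beta> \<in> couplings M \<nu>"
    "(\<integral>z. fst z \<bullet> snd z \<partial>\<gamma>) \<le> (\<integral>z. f (fst z) \<bullet> snd z \<partial>\<beta>) + e * m2 \<nu>"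
proof -
  note [measurable] = f
  have fM [measurable]: "f \<in> M \<rightarrow>\<^sub>M borel"
    unfolding measurable_cong_sets[OF M(2) refl] by (rule f)
  obtain \<alpha> where \<alpha>: "\<alpha> \<in> couplings M \<gamma>"
    and near: "AE w in \<alpha>. dist (f (fst w)) (fst (snd w)) < e"
    using approximate_gluing[OF M couplingsD(1,2)[OF \<gamma>] fM measurable_couplings(1)[OF \<gamma>]
      couplingsD(3)[OF \<gamma>, symmetric] \<open>0 < e\<close>] by blast
  interpret \<alpha>: prob_space \<alpha> by (rule couplingsD[OF \<alpha>])
  define \<beta> where "\<beta> = distr \<alpha> borel (\<lambda>w. (fst w, snd (snd w)))"
  have X: "(\<lambda>w. f (fst w)) \<in> borel_measurable \<alpha>"
    using measurable_compose[OF measurable_couplings(1)[OF \<alpha>] f] .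
  have Z: "(\<lambda>w. fst (snd w)) \<in> borel_measurable \<alpha>" and Y: "(\<lambda>w. snd (snd w)) \<in> borel_measurable \<alpha>"
    using measurable_compose[OF measurable_couplings(2)[OF \<alpha>]] by (auto simp flip: borel_prod)
  note [measurable] = X Y Z
  have sq: "(\<lambda>z::'h \<times> 'h. (norm (fst z))\<^sup>2) \<in> borel_measurable borel"
    "(\<lambda>z::'h \<times> 'h. (norm (snd z))\<^sup>2) \<in> borel_measurable borel"
    "(\<lambda>z::'h \<times> 'h. fst z \<bullet> snd z) \<in> borel_measurable borel"
    by (auto simp flip: borel_prod)
  have iX: "integrable \<alpha> (\<lambda>w. (norm (f (fst w)))\<^sup>2)"
    using f2 by (subst integrable_couplings_fst[OF \<alpha>]) auto
  have iY: "integrable \<alpha> (\<lambda>w. (norm (snd (snd w)))\<^sup>2)"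
    using P2_D(3)[OF \<nu>] sq by (subst integrable_couplings_snd[OF \<alpha>])
      (auto simp: integrable_couplings_snd[OF \<gamma>, of "\<lambda>x. (norm x)\<^sup>2"])
  have nY: "(\<integral>w. (norm (snd (snd w)))\<^sup>2 \<partial>\<alpha>) = (\<integral>y. (norm y)\<^sup>2 \<partial>\<nu>)"
    using sq by (subst integral_couplings_snd[OF \<alpha>])
      (auto simp: integral_couplings_snd[OF \<gamma>, of "\<lambda>x. (norm x)\<^sup>2"])
  have bd: "AE w in \<alpha>. (norm (fst (snd w) - f (fst w)))\<^sup>2 \<le> e\<^sup>2"
    using near by eventually_elim (auto intro!: power_mono simp: dist_norm norm_minus_commute)
  \<comment> \<open>The error is bounded almost everywhere on a probability space, which gives its
    integrability directly.\<close>
  have iD: "integrable \<alpha> (\<lambda>w. (norm (fst (snd w) - f (fst w)))\<^sup>2)"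
    by (rule \<alpha>.integrable_const_bound[where B = "e\<^sup>2"]) (use bd in auto)
  have "(\<integral>w. (norm (fst (snd w) - f (fst w)))\<^sup>2 \<partial>\<alpha>) \<le> (\<integral>w. e\<^sup>2 \<partial>\<alpha>)"
    by (rule integral_mono_AE[OF iD _ bd]) simp
  then have nD: "sqrt (\<integral>w. (norm (fst (snd w) - f (fst w)))\<^sup>2 \<partial>\<alpha>) \<le> e"
    using \<open>0 < e\<close> by (intro real_le_lsqrt) (auto simp: \<alpha>.prob_space)
  have "(\<integral>z. fst z \<bullet> snd z \<partial>\<gamma>) = (\<integral>w. fst (snd w) \<bullet> snd (snd w) \<partial>\<alpha>)"
    using integral_couplings_snd[OF \<alpha> sq(3)] by simp
  also have "\<dots> = (\<integral>w. f (fst w) \<bullet> snd (snd w) + (fst (snd w) - f (fst w)) \<bullet> snd (snd w) \<partial>\<alpha>)"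
    by (simp add: inner_diff_left)
  also have "\<dots> = (\<integral>w. f (fst w) \<bullet> snd (snd w) \<partial>\<alpha>)
      + (\<integral>w. (fst (snd w) - f (fst w)) \<bullet> snd (snd w) \<partial>\<alpha>)"
    by (intro Bochner_Integration.integral_add integrable_inner iX iY iD) auto
  also have "(\<integral>w. (fst (snd w) - f (fst w)) \<bullet> snd (snd w) \<partial>\<alpha>)
      \<le> sqrt (\<integral>w. (norm (fst (snd w) - f (fst w)))\<^sup>2 \<partial>\<alpha>) * m2 \<nu>"
    unfolding m2_def nY[symmetric] by (intro integral_inner_le iD iY) auto
  also have "\<dots> \<le> e * m2 \<nu>"
    using nD by (rule mult_right_mono) (simp add: m2_def)
  finally have le: "(\<integral>z. fst z \<bullet> snd z \<partial>\<gamma>) \<le> (\<integral>w. f (fst w) \<bullet> snd (snd w) \<partial>\<alpha>) + e * m2 \<nu>"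
    by simp
  \<comment> \<open>Below, \<open>couplings_distr\<close> acts by the identity on the first
    coordinate and so returns this image in place of \<open>M\<close>.\<close>
  have "distr M borel (\<lambda>x. x) = M"
    using distr_cong[OF refl M(2), of M "\<lambda>x. x" "\<lambda>x. x"] by simp
  then have "\<beta> \<in> couplings M \<nu>"
    using couplings_distr[OF \<alpha>, of "\<lambda>x. x" snd] couplingsD(4)[OF \<gamma>]
    by (simp add: \<beta>_def flip: borel_prod)
  moreover have "(\<integral>z. f (fst z) \<bullet> snd z \<partial>\<beta>) = (\<integral>w. f (fst w) \<bullet> snd (snd w) \<partial>\<alpha>)"
    unfolding \<beta>_def using measurable_couplings[OF \<alpha>]
    by (subst integral_distr) (auto simp flip: borel_prod)
  ultimately show thesis using le that by simp
qed

text \<open>The bound by the norm of the argument suits the maps needed on the product space: both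
  projections and every interpolation between them.\<close>

lemma distr_in_P2:
  fixes f :: "'a::real_normed_vector \<Rightarrow> 'b::real_normed_vector"
  assumes M: "M \<in> P2" and f: "f \<in> borel_measurable borel" and le: "\<And>x. norm (f x) \<le> norm x"
  shows "distr M borel f \<in> P2" "integrable M (\<lambda>x. (norm (f x))\<^sup>2)"
proof -
  interpret prob_space M by (rule P2_D[OF M])
  note [measurable] = f
  have fM [measurable]: "f \<in> borel_measurable M"
    unfolding measurable_cong_sets[OF P2_D(2)[OF M] refl] by (rule f)
  show i: "integrable M (\<lambda>x. (norm (f x))\<^sup>2)"
    by (rule Bochner_Integration.integrable_bound[OF P2_D(3)[OF M]]) (auto intro: power_mono le)
  then show "distr M borel f \<in> P2"
    using prob_space_distr[OF fM] by (simp add: P2_def integrable_distr_eq)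
qed

text \<open>If \<open>(x, y)\<close> has law \<open>\<beta>\<close>, then the law of
  \<open>(g x, y)\<close> competes in the supremum defining \<open>max_corr\<close>.\<close>

lemma integral_le_max_corr:
  fixes \<nu> :: "'h::{real_inner,second_countable_topology} measure"
    and M :: "'a::second_countable_topology measure"
  assumes \<beta>: "\<beta> \<in> couplings M \<nu>" and g [measurable]: "g \<in> borel \<rightarrow>\<^sub>M borel"
    and P2: "distr M borel g \<in> P2" "\<nu> \<in> P2"
  shows "(\<integral>z. g (fst z) \<bullet> snd z \<partial>\<beta>) \<le> max_corr (distr M borel g) \<nu>"
proof -
  note [measurable] = measurable_couplings[OF \<beta>]
  let ?\<gamma> = "distr \<beta> borel (\<lambda>z. (g (fst z), snd z))"
  have "distr \<nu> borel (\<lambda>x. x) = \<nu>"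
    using distr_cong[OF refl P2_D(2)[OF P2(2)], of \<nu> "\<lambda>x. x" "\<lambda>x. x"] by simp
  then have "?\<gamma> \<in> couplings (distr M borel g) \<nu>"
    using couplings_distr[OF \<beta> g, of "\<lambda>x. x"] by simp
  then have "(\<integral>z. fst z \<bullet> snd z \<partial>?\<gamma>) \<le> max_corr (distr M borel g) \<nu>"
    unfolding max_corr_def by (rule cSUP_upper[OF _ max_corr_bdd_above[OF P2]])
  also have "(\<integral>z. fst z \<bullet> snd z \<partial>?\<gamma>) = (\<integral>z. g (fst z) \<bullet> snd z \<partial>\<beta>)"
    by (subst integral_distr) (auto simp flip: borel_prod)
  finally show ?thesis .
qed

text \<open>Converse to \<open>integral_le_max_corr\<close>: each coupling of the image measure
  lifts to one of \<open>M\<close> with an arbitrarily small loss. Upper bounds may thus be proved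
  on \<open>M\<close>, where several functions of the same point can be compared under one
  coupling.\<close>

lemma max_corr_distr_le:
  fixes M :: "'a::second_countable_topology measure"
    and \<nu> :: "'h::{real_inner,second_countable_topology} measure"
  assumes M: "prob_space M" "sets M = sets borel" and f: "f \<in> borel \<rightarrow>\<^sub>M borel"
    and f2: "integrable M (\<lambda>x. (norm (f x))\<^sup>2)" and P2: "distr M borel f \<in> P2" "\<nu> \<in> P2"
    and le: "\<And>\<beta>. \<beta> \<in> couplings M \<nu> \<Longrightarrow> (\<integral>z. f (fst z) \<bullet> snd z \<partial>\<beta>) \<le> C"
  shows "max_corr (distr M borel f) \<nu> \<le> C"
proof (rule field_le_epsilon)
  fix d :: real assume "0 < d"
  have m: "0 \<le> m2 \<nu>" by (simp add: m2_def)
  \<comment> \<open>The summand 1 keeps the denominator positive when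
    \<open>m2 \<nu> = 0\<close>.\<close>
  define e where "e = d / (m2 \<nu> + 1)"
  have e: "0 < e" "e * m2 \<nu> \<le> d"
    using \<open>0 < d\<close> m by (auto simp: e_def field_simps)
  show "max_corr (distr M borel f) \<nu> \<le> C + d"
    unfolding max_corr_def
  proof (rule cSUP_least[OF couplings_nonempty[OF P2]])
    fix \<gamma> assume "\<gamma> \<in> couplings (distr M borel f) \<nu>"
    then obtain \<beta> where "\<beta> \<in> couplings M \<nu>"
      "(\<integral>z. fst z \<bullet> snd z \<partial>\<gamma>) \<le> (\<integral>z. f (fst z) \<bullet> snd z \<partial>\<beta>) + e * m2 \<nu>"
      using approximate_lifting[OF M f f2 P2(2) _ e(1)] by blast
    with le[of \<beta>] e(2) show "(\<integral>z. fst z \<bullet> snd z \<partial>\<gamma>) \<le> C + d" by linarith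
  qed
qed

lemma borel_measurable_fst_snd:
  "fst \<in> borel_measurable (borel :: ('a::second_countable_topology \<times> 'b::second_countable_topology) measure)"
  "snd \<in> borel_measurable (borel :: ('a::second_countable_topology \<times> 'b::second_countable_topology) measure)"
  by (auto simp flip: borel_prod)

section \<open>Lipschitz bound\<close>

text \<open>For a coupling \<open>\<pi>\<close> of \<open>\<mu>\<close> and \<open>\<mu>'\<close>,
  view \<open>\<mu>\<close> as the image of \<open>\<pi>\<close> under \<open>fst\<close>. A
  coupling of \<open>\<pi>\<close> and \<open>\<nu>\<close> then carries points
  \<open>((x, x'), y)\<close>: the pairing of \<open>x'\<close> with \<open>y\<close> is bounded by
  \<open>max_corr \<mu>' \<nu>\<close>, that of \<open>x - x'\<close> with \<open>y\<close> by
  Cauchy-Schwarz. The infimum over \<open>\<pi>\<close> comes last.\<close>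

lemma max_corr_le_w2:
  fixes \<mu> \<mu>' \<nu> :: "'h::{real_inner,second_countable_topology} measure"
  assumes P2: "\<mu> \<in> P2" "\<mu>' \<in> P2" "\<nu> \<in> P2"
  shows "max_corr \<mu> \<nu> \<le> max_corr \<mu>' \<nu> + m2 \<nu> * w2 \<mu> \<mu>'"
proof -
  have "max_corr \<mu> \<nu> - max_corr \<mu>' \<nu> \<le> m2 \<nu> * sqrt c"
    if \<pi>: "\<pi> \<in> couplings \<mu> \<mu>'" and c: "c = (\<integral>z. (norm (fst z - snd z))\<^sup>2 \<partial>\<pi>)" for \<pi> c
  proof -
    note m = borel_measurable_fst_snd
    have i: "integrable \<pi> (\<lambda>z. (norm (fst z))\<^sup>2)" "integrable \<pi> (\<lambda>z. (norm (snd z))\<^sup>2)"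
      using P2_D(3)[OF P2(1)] P2_D(3)[OF P2(2)]
      by (simp_all add: integrable_couplings_fst[OF \<pi>, of "\<lambda>x. (norm x)\<^sup>2"]
          integrable_couplings_snd[OF \<pi>, of "\<lambda>x. (norm x)\<^sup>2"])
    have "max_corr (distr \<pi> borel fst) \<nu> \<le> max_corr \<mu>' \<nu> + m2 \<nu> * sqrt c"
    proof (rule max_corr_distr_le[OF couplingsD(1,2)[OF \<pi>] m(1) i(1) _ P2(3)])
      fix \<beta> assume \<beta>: "\<beta> \<in> couplings \<pi> \<nu>"
      have [measurable]: "(\<lambda>z. fst (fst z)) \<in> borel_measurable \<beta>"
          "(\<lambda>z. snd (fst z)) \<in> borel_measurable \<beta>" "snd \<in> borel_measurable \<beta>"
        using measurable_compose[OF measurable_couplings(1)[OF \<beta>]] m measurable_couplings(2)[OF \<beta>]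
        by blast+
      have sq: "(\<lambda>z::'h \<times> 'h. (norm (snd z))\<^sup>2) \<in> borel_measurable borel"
        "(\<lambda>z::'h \<times> 'h. (norm (fst z - snd z))\<^sup>2) \<in> borel_measurable borel"
        using m by measurable
      have iX: "integrable \<beta> (\<lambda>z. (norm (snd (fst z)))\<^sup>2)"
        using i(2) integrable_couplings_fst[OF \<beta> sq(1)] by simp
      have iD: "integrable \<beta> (\<lambda>z. (norm (fst (fst z) - snd (fst z)))\<^sup>2)"
        using coupling_integrals(2)[OF P2(1,2) \<pi>] integrable_couplings_fst[OF \<beta> sq(2)] by simp
      have iY: "integrable \<beta> (\<lambda>z. (norm (snd z))\<^sup>2)"
        using P2_D(3)[OF P2(3)] by (simp add: integrable_couplings_snd[OF \<beta>, of "\<lambda>x. (norm x)\<^sup>2"])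
      have "(\<integral>z. fst (fst z) \<bullet> snd z \<partial>\<beta>)
          = (\<integral>z. snd (fst z) \<bullet> snd z + (fst (fst z) - snd (fst z)) \<bullet> snd z \<partial>\<beta>)"
        by (simp add: inner_diff_left)
      also have "\<dots> = (\<integral>z. snd (fst z) \<bullet> snd z \<partial>\<beta>) + (\<integral>z. (fst (fst z) - snd (fst z)) \<bullet> snd z \<partial>\<beta>)"
        by (intro Bochner_Integration.integral_add integrable_inner iX iY iD) auto
      also have "(\<integral>z. snd (fst z) \<bullet> snd z \<partial>\<beta>) \<le> max_corr \<mu>' \<nu>"
        using integral_le_max_corr[OF \<beta> m(2) _ P2(3)] P2(2) by (simp add: couplingsD(4)[OF \<pi>])
      also have "(\<integral>z. (fst (fst z) - snd (fst z)) \<bullet> snd z \<partial>\<beta>)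
          \<le> sqrt (\<integral>z. (norm (fst (fst z) - snd (fst z)))\<^sup>2 \<partial>\<beta>) * sqrt (\<integral>z. (norm (snd z))\<^sup>2 \<partial>\<beta>)"
        by (intro integral_inner_le iD iY) auto
      also have "\<dots> = m2 \<nu> * sqrt c"
        unfolding c m2_def using integral_couplings_fst[OF \<beta> sq(2)]
        by (simp add: integral_couplings_snd[OF \<beta>, of "\<lambda>x. (norm x)\<^sup>2"])
      finally show "(\<integral>z. fst (fst z) \<bullet> snd z \<partial>\<beta>) \<le> max_corr \<mu>' \<nu> + m2 \<nu> * sqrt c"
        by simp
    qed (simp add: couplingsD(3)[OF \<pi>] P2)
    then show ?thesis by (simp add: couplingsD(3)[OF \<pi>])
  qed
  note le = this
  let ?d = "max_corr \<mu> \<nu> - max_corr \<mu>' \<nu>"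
  have m: "0 \<le> m2 \<nu>" by (simp add: m2_def)
  let ?J = "\<lambda>\<pi>. \<integral>z. (norm (fst z - snd z))\<^sup>2 \<partial>\<pi>"
  have J: "0 \<le> (INF \<pi>\<in>couplings \<mu> \<mu>'. ?J \<pi>)"
    \<comment> \<open>This makes \<open>w2\<close> nonnegative; the real \<open>sqrt\<close> is
      negative at negative arguments.\<close>
    by (rule cINF_greatest[OF couplings_nonempty[OF P2(1,2)]]) simp
  show ?thesis
  \<comment> \<open>The infimum stands under the square root, so the bound for each
    \<open>\<pi>\<close> is squared first, which needs the sign of \<open>?d\<close>.\<close>
  proof (cases "?d \<le> 0")
    case True
    have "0 \<le> m2 \<nu> * w2 \<mu> \<mu>'" using m J by (simp add: w2_def)
    with True show ?thesis by linarith
  next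
    case False
    obtain \<pi> where "\<pi> \<in> couplings \<mu> \<mu>'" using couplings_nonempty[OF P2(1,2)] by blast
    \<comment> \<open>If \<open>m2 \<nu>\<close> were 0, the bound for a single coupling would
      already force \<open>?d \<le> 0\<close>.\<close>
    from le[OF this refl] False m have m0: "0 < m2 \<nu>" by (cases "m2 \<nu> = 0") auto
    have "(?d / m2 \<nu>)\<^sup>2 \<le> (INF \<pi>\<in>couplings \<mu> \<mu>'. ?J \<pi>)"
    proof (rule cINF_greatest[OF couplings_nonempty[OF P2(1,2)]])
      fix \<pi> assume "\<pi> \<in> couplings \<mu> \<mu>'"
      from le[OF this refl] have "?d / m2 \<nu> \<le> sqrt (?J \<pi>)"
        using m0 by (simp add: field_simps)
      then have "(?d / m2 \<nu>)\<^sup>2 \<le> (sqrt (?J \<pi>))\<^sup>2"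
        using False m0 by (intro power_mono) auto
      then show "(?d / m2 \<nu>)\<^sup>2 \<le> ?J \<pi>" by simp
    qed
    then have "?d / m2 \<nu> \<le> w2 \<mu> \<mu>'"
      unfolding w2_def by (rule real_le_rsqrt)
    then show ?thesis using m0 by (simp add: field_simps)
  qed
qed

text \<open>Swapping coordinates exchanges the marginals and keeps the cost, so both infima run over
  the same set of values. The inclusion \<open>sub\<close> is proved for arbitrary marginals and is
  used in both directions.\<close>

lemma w2_commute:
  fixes \<mu> \<mu>' :: "'h::{real_normed_vector,second_countable_topology} measure"
  shows "w2 \<mu> \<mu>' = w2 \<mu>' \<mu>"
proof -
  let ?J = "\<lambda>\<pi>. \<integral>z. (norm (fst z - snd z))\<^sup>2 \<partial>(\<pi> :: ('h \<times> 'h) measure)"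
  have sub: "?J ` couplings \<mu> \<mu>' \<subseteq> ?J ` couplings \<mu>' \<mu>" for \<mu> \<mu>'
  proof
    fix c assume "c \<in> ?J ` couplings \<mu> \<mu>'"
    then obtain \<pi> where \<pi>: "\<pi> \<in> couplings \<mu> \<mu>'" "c = ?J \<pi>" by blast
    note [measurable] = measurable_couplings[OF \<pi>(1)]
    interpret prob_space \<pi> by (rule couplingsD[OF \<pi>(1)])
    let ?s = "\<lambda>z. (snd z, fst z)"
    have m: "?s \<in> \<pi> \<rightarrow>\<^sub>M borel" by (simp flip: borel_prod)
    have "distr (distr \<pi> borel ?s) borel fst = distr \<pi> borel snd"
      "distr (distr \<pi> borel ?s) borel snd = distr \<pi> borel fst"
      using m by (subst distr_distr; auto simp: comp_def simp flip: borel_prod)+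
    then have "distr \<pi> borel ?s \<in> couplings \<mu>' \<mu>"
      using prob_space_distr[OF m] by (simp add: couplings_def couplingsD(3,4)[OF \<pi>(1)])
    moreover have "?J (distr \<pi> borel ?s) = c"
      unfolding \<pi>(2) using m
      by (subst integral_distr) (auto simp: norm_minus_commute simp flip: borel_prod)
    ultimately show "c \<in> ?J ` couplings \<mu>' \<mu>" by blast
  qed
  then show ?thesis
    unfolding w2_def by (intro arg_cong[where f = sqrt] arg_cong[where f = Inf] antisym)
qed

section \<open>Total convexity\<close>

text \<open>Under a coupling of \<open>M\<close> and \<open>\<nu>\<close>, the pairing of the
  interpolated point with \<open>y\<close> is the convex combination of the pairings of the two end
  points with the same \<open>y\<close>. Each of these is bounded by its own maximal
  correlation.\<close>

lemma max_corr_totally_convex: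
  fixes \<nu> :: "'h::{real_inner,second_countable_topology} measure" and M :: "('h \<times> 'h) measure"
  assumes M: "M \<in> P2" and \<nu>: "\<nu> \<in> P2" and t: "t \<in> {0..1::real}"
  shows "max_corr (distr M borel (\<lambda>z. (1 - t) *\<^sub>R fst z + t *\<^sub>R snd z)) \<nu>
    \<le> (1 - t) * max_corr (distr M borel fst) \<nu> + t * max_corr (distr M borel snd) \<nu>"
proof -
  note m = borel_measurable_fst_snd
  let ?f = "\<lambda>z::'h \<times> 'h. (1 - t) *\<^sub>R fst z + t *\<^sub>R snd z"
  have f: "?f \<in> borel_measurable borel" using m by measurable
  have n: "norm (fst z) \<le> norm z" "norm (snd z) \<le> norm z" for z :: "'h \<times> 'h"
    by (metis norm_fst_le prod.collapse) (metis norm_snd_le prod.collapse)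
  have "norm (?f z) \<le> norm z" for z
  proof -
    have "norm (?f z) \<le> (1 - t) * norm (fst z) + t * norm (snd z)"
      using t by (intro norm_triangle_le) auto
    also have "\<dots> \<le> (1 - t) * norm z + t * norm z"
      using t by (intro add_mono mult_left_mono n) auto
    finally show ?thesis by (simp add: algebra_simps)
  qed
  note fP = distr_in_P2[OF M f this]
  note P1 = distr_in_P2[OF M m(1) n(1)] and P2 = distr_in_P2[OF M m(2) n(2)]
  show ?thesis
  proof (rule max_corr_distr_le[OF P2_D(1,2)[OF M] f fP(2,1) \<nu>])
    fix \<beta> assume \<beta>: "\<beta> \<in> couplings M \<nu>"
    have meas: "(\<lambda>z. fst (fst z)) \<in> borel_measurable \<beta>"
        "(\<lambda>z. snd (fst z)) \<in> borel_measurable \<beta>" "snd \<in> borel_measurable \<beta>"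
      using measurable_compose[OF measurable_couplings(1)[OF \<beta>]] m measurable_couplings(2)[OF \<beta>]
      by blast+
    have sq: "(\<lambda>z::'h \<times> 'h. (norm (fst z))\<^sup>2) \<in> borel_measurable borel"
      "(\<lambda>z::'h \<times> 'h. (norm (snd z))\<^sup>2) \<in> borel_measurable borel"
      using m by measurable
    have iY: "integrable \<beta> (\<lambda>z. (norm (snd z))\<^sup>2)"
      using P2_D(3)[OF \<nu>] by (simp add: integrable_couplings_snd[OF \<beta>, of "\<lambda>x. (norm x)\<^sup>2"])
    have iX: "integrable \<beta> (\<lambda>z. (norm (fst (fst z)))\<^sup>2)" "integrable \<beta> (\<lambda>z. (norm (snd (fst z)))\<^sup>2)"
      using P1(2) P2(2) integrable_couplings_fst[OF \<beta> sq(1)] integrable_couplings_fst[OF \<beta> sq(2)]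
      by simp_all
    have "(\<integral>z. ?f (fst z) \<bullet> snd z \<partial>\<beta>)
        = (\<integral>z. (1 - t) * (fst (fst z) \<bullet> snd z) + t * (snd (fst z) \<bullet> snd z) \<partial>\<beta>)"
      by (simp add: inner_add_left)
    also have "\<dots> = (1 - t) * (\<integral>z. fst (fst z) \<bullet> snd z \<partial>\<beta>) + t * (\<integral>z. snd (fst z) \<bullet> snd z \<partial>\<beta>)"
      using integrable_inner[OF meas(1,3) iX(1) iY] integrable_inner[OF meas(2,3) iX(2) iY] by simp
    also have "\<dots> \<le> (1 - t) * max_corr (distr M borel fst) \<nu> + t * max_corr (distr M borel snd) \<nu>"
      using t by (intro add_mono mult_left_mono integral_le_max_corr[OF \<beta>] m P1 P2 \<nu>) auto
    finally show "(\<integral>z. ?f (fst z) \<bullet> snd z \<partial>\<beta>)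
        \<le> (1 - t) * max_corr (distr M borel fst) \<nu> + t * max_corr (distr M borel snd) \<nu>" .
  qed
qed

theorem proposition3p5:
  fixes \<nu> :: "'h::{real_inner, complete_space, second_countable_topology} measure"
  assumes "\<nu> \<in> P2"
  shows "lipschitz_w2 (m2 \<nu>) (k_fun \<nu>) \<and> totally_convex (\<lambda>\<mu>. ereal (k_fun \<nu> \<mu>))"
proof
  \<comment> \<open>The one-sided bound is used in both orders of \<open>\<mu>\<close> and
    \<open>\<mu>'\<close>, with \<open>w2\<close> symmetric.\<close>
  have "\<bar>max_corr \<mu> \<nu> - max_corr \<mu>' \<nu>\<bar> \<le> m2 \<nu> * w2 \<mu> \<mu>'" if "\<mu> \<in> P2" "\<mu>' \<in> P2" for \<mu> \<mu>'
    using max_corr_le_w2[OF that assms] max_corr_le_w2[OF that(2,1) assms] w2_commute[of \<mu> \<mu>']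
    by simp
  then show "lipschitz_w2 (m2 \<nu>) (k_fun \<nu>)"
    by (simp add: lipschitz_w2_def k_fun_def m2_def)
  show "totally_convex (\<lambda>\<mu>. ereal (k_fun \<nu> \<mu>))"
    using max_corr_totally_convex[OF _ assms] by (simp add: totally_convex_def k_fun_def)
qed

end
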